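(* For every integer $t\geq 1$: (a) there is a $K_{3t+2}$-minor-free graph that is not $4t$-choosable; (b) there is a $K_{3t+1}$-minor-free graph that is not $(4t-2)$-choosable; (c) there is a $K_{3t}$-minor-free graph that is not $(4t-3)$-choosable.
   Context: All graphs are finite and simple. A graph $G$ is $K_p$-minor-free if the complete graph $K_p$ is not a minor of $G$. A list-assignment of $G$ is a function $L$ assigning to each vertex $v$ a set $L(v)$ of colours; $G$ is $L$-colourable if there is a proper colouring of $G$ in which each vertex $v$ receives a colour from $L(v)$. $G$ is $k$-choosable if $G$ is $L$-colourable for every list-assignment $L$ with $|L(v)|\geq k$ for every vertex $v$. *)

theory Defs
  imports "Graph_Theory.Graph_Theory"
begin

text \<open>Finite simple graphs are the loop-free symmetric pair digraphs of the locale
  \<open>pair_graph\<close>: an edge \<open>uv\<close> is the pair of arcs \<open>(u, v)\<close> and \<open>(v, u)\<close>.\<close>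

text \<open>Contracting the edge \<open>uv\<close>: the merged vertex is called \<open>u\<close>; the resulting loops are
  discarded and parallel edges are identified.\<close>

definition contract_edge :: "'a pair_pre_digraph \<Rightarrow> 'a \<Rightarrow> 'a \<Rightarrow> 'a pair_pre_digraph" where
  "contract_edge G u v =
     (let f = (\<lambda>x. if x = v then u else x) in
      \<lparr> pverts = pverts G - {v},
        parcs = {(f x, f y) |x y. (x, y) \<in> parcs G \<and> f x \<noteq> f y} \<rparr>)"

definition contraction_step :: "'a pair_pre_digraph \<Rightarrow> 'a pair_pre_digraph \<Rightarrow> bool" where
  "contraction_step G G' \<longleftrightarrow> (\<exists>u v. (u, v) \<in> parcs G \<and> G' = contract_edge G u v)"

text \<open>\<open>H\<close> is a minor of \<open>G\<close> if a graph isomorphic to \<open>H\<close> arises from a subgraph of \<open>G\<close> by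
  contracting edges. The library's \<open>subgraph\<close> concerns digraphs and may drop just one of the two
  arcs of an edge, so the subgraph is required to be a \<open>pair_graph\<close> again.\<close>

definition minor :: "'b pair_pre_digraph \<Rightarrow> 'a pair_pre_digraph \<Rightarrow> bool" where
  "minor H G \<longleftrightarrow>
     (\<exists>S M. pair_graph S \<and> subgraph (with_proj S) (with_proj G) \<and>
        contraction_step\<^sup>*\<^sup>* S M \<and> digraph_iso (with_proj M) (with_proj H))"

definition complete_minor_free :: "nat \<Rightarrow> 'a pair_pre_digraph \<Rightarrow> bool" where
  "complete_minor_free p G \<longleftrightarrow>
     (\<forall>H :: nat pair_pre_digraph. K\<^bsub>p\<^esub> (with_proj H) \<longrightarrow> \<not> minor H G)"

definition proper_colouring :: "'a pair_pre_digraph \<Rightarrow> ('a \<Rightarrow> 'c) \<Rightarrow> bool" where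
  "proper_colouring G c \<longleftrightarrow> (\<forall>(u, v) \<in> parcs G. c u \<noteq> c v)"

definition list_colourable :: "'a pair_pre_digraph \<Rightarrow> ('a \<Rightarrow> 'c set) \<Rightarrow> bool" where
  "list_colourable G L \<longleftrightarrow>
     (\<exists>c. proper_colouring G c \<and> (\<forall>v \<in> pverts G. c v \<in> L v))"

text \<open>Natural numbers suffice as colours: for a finite graph each list may be cut down to \<open>k\<close>
  colours, so that only finitely many colours occur. As \<open>card\<close> is \<open>0\<close> on infinite sets,
  infinite lists are admitted separately.\<close>

definition choosable :: "nat \<Rightarrow> 'a pair_pre_digraph \<Rightarrow> bool" where
  "choosable k G \<longleftrightarrow>
     (\<forall>L :: 'a \<Rightarrow> nat set.
        (\<forall>v \<in> pverts G. infinite (L v) \<or> k \<le> card (L v)) \<longrightarrow> list_colourable G L)"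

end

theory Submission
  imports Defs
begin

text \<open>Let \<open>H\<close> be the graph obtained from the complete multipartite graph with \<open>r\<close> classes
  \<open>{s\<^sub>i, v\<^sub>i}\<close> by adding \<open>d\<close> dominant vertices. The \<open>s\<^sub>i\<close> and the dominant vertices form a
  clique, the hub. Once the hub is coloured injectively, giving each \<open>v\<^sub>i\<close> the colours of its hub
  neighbours and \<open>r - 1\<close> further common colours leaves just \<open>r - 1\<close> colours for the clique
  \<open>v\<^sub>1, \<dots>, v\<^sub>r\<close>. These lists have size \<open>2 r - 2 + d\<close>, and pasting onto one hub a copy of \<open>H\<close> for
  every colouring of the hub defeats all colourings at once.

  The branch sets of a clique minor of the pasted graph may be restricted to one copy of \<open>H\<close>. At
  most \<open>r + d\<close> of the restricted sets are singletons, because singletons are pairwise adjacent; as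
  \<open>H\<close> has \<open>2 r + d\<close> vertices, twice the order of the minor is at most \<open>3 r + 2 d\<close>. The three claims
  are the cases \<open>(r, d) = (2 t + 1, 0)\<close>, \<open>(2 t, 0)\<close> and \<open>(2 t - 1, 1)\<close>.\<close>

section \<open>Branch sets of a minor\<close>

text \<open>Connectedness of the branch sets is expressed by cuts, which makes it immediate that
  merging two branch sets along an arc preserves it.\<close>

definition cut_connected :: "('a \<times> 'a) set \<Rightarrow> 'a set \<Rightarrow> bool" where
  "cut_connected R B \<longleftrightarrow>
     (\<forall>U. B \<inter> U \<noteq> {} \<and> B - U \<noteq> {} \<longrightarrow>
        (\<exists>a\<in>B \<inter> U. \<exists>b\<in>B - U. (a, b) \<in> R \<or> (b, a) \<in> R))"

lemma cut_connected_singleton: "cut_connected R {x}"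
  by (auto simp: cut_connected_def)

text \<open>A cut of the union either splits one of the two sets, whose own connectedness supplies a
  crossing arc, or separates them from each other, and then \<open>(a, b)\<close> crosses
  it.\<close>

lemma cut_connected_Un:
  assumes "cut_connected R A" "cut_connected R B" "a \<in> A" "b \<in> B" "(a, b) \<in> R"
  shows "cut_connected R (A \<union> B)"
  unfolding cut_connected_def
proof (intro allI impI)
  fix U assume U: "(A \<union> B) \<inter> U \<noteq> {} \<and> (A \<union> B) - U \<noteq> {}"
  consider "A \<inter> U \<noteq> {} \<and> A - U \<noteq> {}" | "B \<inter> U \<noteq> {} \<and> B - U \<noteq> {}"
    | "A \<subseteq> U \<and> B \<inter> U = {}" | "B \<subseteq> U \<and> A \<inter> U = {}"
    using U by blast
  then show "\<exists>a\<in>(A \<union> B) \<inter> U. \<exists>b\<in>(A \<union> B) - U. (a, b) \<in> R \<or> (b, a) \<in> R"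
  proof cases
    case 1
    then show ?thesis using assms(1) unfolding cut_connected_def by blast
  next
    case 2
    then show ?thesis using assms(2) unfolding cut_connected_def by blast
  next
    case 3
    then show ?thesis using assms(3-5) by blast
  next
    case 4
    then show ?thesis using assms(3-5) by blast
  qed
qed

text \<open>\<open>\<phi>\<close> sends a vertex of \<open>S\<close> to the vertex of
  \<open>M\<close> into which it is contracted, so the branch sets are the fibres of
  \<open>\<phi>\<close>.\<close>

definition branch_map :: "'a pair_pre_digraph \<Rightarrow> 'a pair_pre_digraph \<Rightarrow> ('a \<Rightarrow> 'a) \<Rightarrow> bool" where
  "branch_map S M \<phi> \<longleftrightarrow>
     \<phi> ` pverts S = pverts M \<and>
     (\<forall>(x, y)\<in>parcs M. x \<noteq> y \<and> (\<exists>(a, b)\<in>parcs S. \<phi> a = x \<and> \<phi> b = y)) \<and>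
     (\<forall>w\<in>pverts M. cut_connected (parcs S) {x \<in> pverts S. \<phi> x = w})"

lemma (in pair_graph) branch_map_id: "branch_map G G id"
proof -
  have "{x \<in> pverts G. x = w} = {w}" if "w \<in> pverts G" for w
    using that by auto
  then show ?thesis
    using pair_no_loops by (fastforce simp: branch_map_def cut_connected_singleton)
qed

text \<open>Compose \<open>\<phi>\<close> with the contraction. Only the fibre of \<open>u\<close>
  grows: it absorbs that of \<open>v\<close>, and an arc of \<open>G\<close> lying over
  \<open>(u, v)\<close> joins the two.\<close>

lemma (in pair_wf_digraph) branch_map_step:
  assumes \<phi>: "branch_map G M \<phi>" and "contraction_step M M'"
  shows "\<exists>\<psi>. branch_map G M' \<psi>"
proof -
  obtain u v where uv: "(u, v) \<in> parcs M" and M': "M' = contract_edge M u v"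
    using assms(2) by (auto simp: contraction_step_def)
  define f where "f = (\<lambda>x. if x = v then u else x)"
  have pv: "pverts M' = pverts M - {v}"
    and pa: "parcs M' = {(f x, f y) |x y. (x, y) \<in> parcs M \<and> f x \<noteq> f y}"
    by (simp_all add: M' contract_edge_def f_def)
  have im: "\<phi> ` pverts G = pverts M"
    and arc: "\<And>x y. (x, y) \<in> parcs M \<Longrightarrow> x \<noteq> y \<and> (\<exists>a b. (a, b) \<in> parcs G \<and> \<phi> a = x \<and> \<phi> b = y)"
    and con: "\<And>w. w \<in> pverts M \<Longrightarrow> cut_connected (parcs G) {x \<in> pverts G. \<phi> x = w}"
    using \<phi> by (fastforce simp: branch_map_def)+
  obtain a b where ab: "(a, b) \<in> parcs G" "\<phi> a = u" "\<phi> b = v" and "u \<noteq> v"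
    using arc[OF uv] by blast
  have G: "a \<in> pverts G" "b \<in> pverts G" using ab(1) by (auto dest: wellformed')
  then have M: "u \<in> pverts M" "v \<in> pverts M" using im ab by auto
  have "(f \<circ> \<phi>) ` pverts G = pverts M'"
  proof -
    have "f ` pverts M = pverts M - {v}" using M \<open>u \<noteq> v\<close> by (auto simp: f_def image_iff)
    then show ?thesis by (simp only: image_comp[symmetric] im pv)
  qed
  moreover have "x \<noteq> y \<and> (\<exists>(a, b)\<in>parcs G. (f \<circ> \<phi>) a = x \<and> (f \<circ> \<phi>) b = y)"
    if "(x, y) \<in> parcs M'" for x y
    using that arc unfolding pa by fastforce
  moreover have "cut_connected (parcs G) {x \<in> pverts G. (f \<circ> \<phi>) x = w}" if "w \<in> pverts M'" for w
  proof (cases "w = u")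
    case True
    have "{x \<in> pverts G. (f \<circ> \<phi>) x = w} = {x \<in> pverts G. \<phi> x = u} \<union> {x \<in> pverts G. \<phi> x = v}"
      using True by (auto simp: f_def)
    then show ?thesis
      using cut_connected_Un[OF con[OF M(1)] con[OF M(2)], of a b] ab G by simp
  next
    case False
    then have "{x \<in> pverts G. (f \<circ> \<phi>) x = w} = {x \<in> pverts G. \<phi> x = w}"
      using that pv by (auto simp: f_def)
    then show ?thesis using con that pv by auto
  qed
  ultimately show ?thesis unfolding branch_map_def by (intro exI[of _ "f \<circ> \<phi>"]) blast
qed

lemma (in pair_graph) branch_map_contractions:
  assumes "contraction_step\<^sup>*\<^sup>* G M"
  shows "\<exists>\<phi>. branch_map G M \<phi>"
  using assms by induction (use branch_map_id branch_map_step in blast)+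

text \<open>A digraph isomorphism maps vertices and arcs separately. Since the image is
  \<open>with_proj H\<close>, its tail and head are the projections, which forces the arc map to
  follow the vertex map.\<close>

lemma complete_iso_pair:
  assumes K: "K\<^bsub>p\<^esub> (with_proj H)" and iso: "digraph_iso (with_proj M) (with_proj H)"
  shows "card (pverts M) = p"
    and "\<And>x y. x \<in> pverts M \<Longrightarrow> y \<in> pverts M \<Longrightarrow> x \<noteq> y \<Longrightarrow> (x, y) \<in> parcs M"
proof -
  obtain h where h: "pre_digraph.digraph_isomorphism (with_proj M) h"
    and H: "with_proj H = app_iso h (with_proj M)"
    using iso by (auto simp: digraph_iso_def)
  have wf: "pair_wf_digraph M" and inj: "inj_on (iso_verts h) (pverts M)"
    and ends: "\<And>a. a \<in> parcs M \<Longrightarrow> iso_verts h (fst a) = iso_tail h (iso_arcs h a) \<and>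
      iso_verts h (snd a) = iso_head h (iso_arcs h a)"
    using h by (auto simp: pre_digraph.digraph_isomorphism_def wf_digraph_wp_iff)
  have V: "pverts H = iso_verts h ` pverts M" and A: "parcs H = iso_arcs h ` parcs M"
    and th: "iso_tail h = fst" "iso_head h = snd"
    using arg_cong[OF H, of verts] arg_cong[OF H, of arcs]
      arg_cong[OF H, of tail] arg_cong[OF H, of head] by simp_all
  show "card (pverts M) = p"
    using K inj by (simp add: complete_digraph_pair_def V card_image)
  fix x y assume xy: "x \<in> pverts M" "y \<in> pverts M" "x \<noteq> y"
  then have "iso_verts h x \<noteq> iso_verts h y" using inj by (auto dest: inj_onD)
  then have "(iso_verts h x, iso_verts h y) \<in> parcs H"
    using K xy by (auto simp: complete_digraph_pair_def V)
  then obtain a where a: "a \<in> parcs M" "iso_arcs h a = (iso_verts h x, iso_verts h y)"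
    using A by (metis imageE)
  have "iso_verts h (fst a) = iso_verts h x" "iso_verts h (snd a) = iso_verts h y"
    using ends[OF a(1)] a(2) th by auto
  moreover have "fst a \<in> pverts M" "snd a \<in> pverts M"
    using pair_wf_digraph.arc_fst_in_verts[OF wf] pair_wf_digraph.arc_snd_in_verts[OF wf] a(1)
    by blast+
  ultimately have "fst a = x" "snd a = y" using inj xy by (auto dest: inj_onD)
  then show "(x, y) \<in> parcs M" using a(1) by (metis prod.collapse)
qed

lemma complete_minor_branch_map:
  assumes "minor H G" and "K\<^bsub>p\<^esub> (with_proj H)"
  obtains S M \<phi> where "pair_graph S" "pverts S \<subseteq> pverts G" "parcs S \<subseteq> parcs G"
    "branch_map S M \<phi>" "card (pverts M) = p"
    "\<And>x y. x \<in> pverts M \<Longrightarrow> y \<in> pverts M \<Longrightarrow> x \<noteq> y \<Longrightarrow> (x, y) \<in> parcs M"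
proof -
  obtain S M where S: "pair_graph S" "subgraph (with_proj S) (with_proj G)"
    "contraction_step\<^sup>*\<^sup>* S M" and iso: "digraph_iso (with_proj M) (with_proj H)"
    using assms(1) by (auto simp: minor_def)
  obtain \<phi> where "branch_map S M \<phi>"
    using pair_graph.branch_map_contractions[OF S(1,3)] by blast
  then show thesis
    using that[of S M \<phi>] S complete_iso_pair[OF assms(2) iso] by (auto simp: subgraph_def)
qed

section \<open>The pasted graph\<close>

text \<open>The vertex coded by \<open>(j, i)\<close> has index \<open>i\<close>; it lies in the hub if \<open>j = 0\<close>, and in the
  \<open>j\<close>-th pasted clique otherwise.\<close>

definition block :: "nat \<Rightarrow> nat" where "block x = fst (prod_decode x)"

definition idx :: "nat \<Rightarrow> nat" where "idx x = snd (prod_decode x)"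

lemma block_encode [simp]: "block (prod_encode (j, i)) = j"
  and idx_encode [simp]: "idx (prod_encode (j, i)) = i"
  by (simp_all add: block_def idx_def)

lemma vertex_eqI: "block x = block y \<Longrightarrow> idx x = idx y \<Longrightarrow> x = y"
  unfolding block_def idx_def by (metis prod.collapse prod_decode_inverse)

definition pasted_verts :: "nat \<Rightarrow> nat \<Rightarrow> nat \<Rightarrow> nat set" where
  "pasted_verts N r d = prod_encode ` ({0} \<times> {..<r + d} \<union> {1..N} \<times> {..<r})"

text \<open>Equal indices mark the non-adjacent pairs of a class. Indices from \<open>r\<close> on
  occur in the hub only, so these hub vertices are the dominant ones.\<close>

definition pasted :: "nat \<Rightarrow> nat \<Rightarrow> nat \<Rightarrow> nat pair_pre_digraph" where
  "pasted N r d =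
     \<lparr> pverts = pasted_verts N r d,
       parcs = {(x, y). x \<in> pasted_verts N r d \<and> y \<in> pasted_verts N r d \<and> idx x \<noteq> idx y \<and>
                  (block x = 0 \<or> block y = 0 \<or> block x = block y)} \<rparr>"

lemma finite_pasted_verts: "finite (pasted_verts N r d)"
  by (simp add: pasted_verts_def)

lemma pair_graph_pasted: "pair_graph (pasted N r d)"
proof -
  have "finite (parcs (pasted N r d))"
    by (rule finite_subset[of _ "pasted_verts N r d \<times> pasted_verts N r d"])
      (auto simp: pasted_def finite_pasted_verts)
  then show ?thesis
    by unfold_locales
      (auto simp: pasted_def finite_pasted_verts symmetric_def intro!: symI)
qed

lemma idx_less: "x \<in> pasted_verts N r d \<Longrightarrow> idx x < r + d"
  by (auto simp: pasted_verts_def)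

lemma card_hub: "card {x \<in> pasted_verts N r d. block x = 0} \<le> r + d"
proof -
  have "{x \<in> pasted_verts N r d. block x = 0} \<subseteq> prod_encode ` ({0} \<times> {..<r + d})"
    by (auto simp: pasted_verts_def)
  then have "card {x \<in> pasted_verts N r d. block x = 0} \<le> card (prod_encode ` ({0} \<times> {..<r + d}))"
    by (intro card_mono) auto
  also have "\<dots> \<le> r + d"
    using card_image_le[of "{0::nat} \<times> {..<r + d}" prod_encode] by (simp add: card_cartesian_product)
  finally show ?thesis .
qed

lemma card_hub_block: "card {x \<in> pasted_verts N r d. block x = 0 \<or> block x = j} \<le> 2 * r + d"
proof -
  have "{x \<in> pasted_verts N r d. block x = 0 \<or> block x = j} \<subseteq>
      {x \<in> pasted_verts N r d. block x = 0} \<union> prod_encode ` ({j} \<times> {..<r})"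
    by (auto simp: pasted_verts_def)
  then have "card {x \<in> pasted_verts N r d. block x = 0 \<or> block x = j} \<le>
      card ({x \<in> pasted_verts N r d. block x = 0} \<union> prod_encode ` ({j} \<times> {..<r}))"
    by (intro card_mono) (auto simp: finite_pasted_verts)
  also have "\<dots> \<le> card {x \<in> pasted_verts N r d. block x = 0} + card (prod_encode ` ({j} \<times> {..<r}))"
    by (rule card_Un_le)
  also have "\<dots> \<le> (r + d) + r"
    using card_hub[of N r d] card_image_le[of "{j} \<times> {..<r}" prod_encode]
    by (intro add_mono) (simp_all add: card_cartesian_product)
  finally show ?thesis by simp
qed

section \<open>Clique minors of the pasted graph\<close>

lemma complete_minor_free_pasted:
  assumes p: "3 * r + 2 * d < 2 * p"
  shows "complete_minor_free p (pasted N r d)"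
  unfolding complete_minor_free_def
proof (intro allI impI notI)
  fix H :: "nat pair_pre_digraph"
  assume K: "K\<^bsub>p\<^esub> (with_proj H)" and minor: "minor H (pasted N r d)"
  obtain S M \<phi> where S: "pair_graph S" "pverts S \<subseteq> pverts (pasted N r d)"
    "parcs S \<subseteq> parcs (pasted N r d)"
    and \<phi>: "branch_map S M \<phi>" and cM: "card (pverts M) = p"
    and M: "\<And>x y. x \<in> pverts M \<Longrightarrow> y \<in> pverts M \<Longrightarrow> x \<noteq> y \<Longrightarrow> (x, y) \<in> parcs M"
    by (rule complete_minor_branch_map[OF minor K]) blast
  interpret S: pair_graph S by (fact S(1))
  define W V where "W = pverts M" and "V = pasted_verts N r d"
  define B where "B w = {x \<in> pverts S. \<phi> x = w}" for w
  have finV: "finite V" by (simp add: V_def finite_pasted_verts)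
  have finS: "finite (pverts S)" by (rule S.pair_finite_verts)
  have SV: "pverts S \<subseteq> V" using S(2) by (simp add: pasted_def V_def)
  have im: "\<phi> ` pverts S = W" using \<phi> by (simp add: branch_map_def W_def)
  have finW: "finite W" using im finS by auto
  have BV: "B w \<subseteq> V" for w using SV by (auto simp: B_def)
  have adj: "idx a \<noteq> idx b \<and> (block a = 0 \<or> block b = 0 \<or> block a = block b)"
    if "(a, b) \<in> parcs S" for a b
    using that S(3) by (auto simp: pasted_def)
  have edge: "\<exists>a\<in>B x. \<exists>b\<in>B y. (a, b) \<in> parcs S" if "x \<in> W" "y \<in> W" "x \<noteq> y" for x y
  proof -
    have "(x, y) \<in> parcs M" using that M by (simp add: W_def)
    then obtain a b where "(a, b) \<in> parcs S" "\<phi> a = x" "\<phi> b = y"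
      using \<phi> by (fastforce simp: branch_map_def)
    then show ?thesis by (auto simp: B_def dest: S.wellformed')
  qed
  \<comment> \<open>Arcs that avoid the hub stay inside one block, so a connected set off the hub
    cannot cross the cut given by the block of \<open>x\<close>.\<close>
  have confined: "block y = block x"
    if w: "w \<in> W" and off: "\<forall>x\<in>B w. block x \<noteq> 0" and x: "x \<in> B w" and y: "y \<in> B w" for w x y
  proof (rule ccontr)
    assume ne: "block y \<noteq> block x"
    have "cut_connected (parcs S) (B w)"
      using \<phi> w by (simp add: branch_map_def W_def B_def)
    moreover have "B w \<inter> {z. block z = block x} \<noteq> {}" "B w - {z. block z = block x} \<noteq> {}"
      using x y ne by auto
    ultimately obtain a b where "a \<in> B w" "b \<in> B w" "block a = block x" "block b \<noteq> block x"
      "(a, b) \<in> parcs S \<or> (b, a) \<in> parcs S"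
      unfolding cut_connected_def by blast
    then show False using adj off by metis
  qed
  \<comment> \<open>If every branch set met the hub, there would be at most \<open>r + d\<close> of
    them, too few for \<open>p\<close>. The block of \<open>w0\<close> selects the copy to restrict
    to.\<close>
  have "\<exists>w0\<in>W. \<forall>x\<in>B w0. block x \<noteq> 0"
  proof (rule ccontr)
    assume "\<not> ?thesis"
    then have "W \<subseteq> \<phi> ` {x \<in> V. block x = 0}"
      using SV by (force simp: B_def)
    then have "card W \<le> card {x \<in> V. block x = 0}"
      using finV by (auto intro: surj_card_le)
    also have "\<dots> \<le> r + d" unfolding V_def by (rule card_hub)
    finally show False using p cM by (simp add: W_def)
  qed
  then obtain w0 where w0: "w0 \<in> W" "\<forall>x\<in>B w0. block x \<noteq> 0" by blast
  obtain x0 where x0: "x0 \<in> B w0" using w0(1) im by (auto simp: B_def)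
  define j where "j = block x0"
  have j0: "j \<noteq> 0" using w0 x0 by (simp add: j_def)
  have w0j: "block x = j" if "x \<in> B w0" for x
    using confined[OF w0 x0 that] by (simp add: j_def)
  define C where "C w = {x \<in> B w. block x = 0 \<or> block x = j}" for w
  have finC: "finite (C w)" for w using finS by (simp add: C_def B_def)
  \<comment> \<open>Every other branch set is adjacent to that of \<open>w0\<close>, and neighbours
    of block \<open>j\<close> lie in block \<open>j\<close> or in the hub.\<close>
  have C_ne: "C w \<noteq> {}" if w: "w \<in> W" for w
  proof (cases "w = w0")
    case True
    then show ?thesis using x0 by (auto simp: C_def j_def)
  next
    case False
    then obtain a b where "a \<in> B w0" "b \<in> B w" "(a, b) \<in> parcs S"
      using edge[OF w0(1) w] by auto
    then show ?thesis using adj[of a b] w0j[of a] j0 by (auto simp: C_def)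
  qed
  define W1 where "W1 = {w \<in> W. card (C w) = 1}"
  \<comment> \<open>Here the branch set of \<open>w\<close> misses the hub, so it lies in block
    \<open>j\<close> and restriction loses nothing. Its arc to the branch set of \<open>w'\<close>
    therefore survives and joins \<open>x\<close> to \<open>y\<close>.\<close>
  have off_hub: "idx x \<noteq> idx y"
    if w: "w \<in> W" "w' \<in> W" "w \<noteq> w'" and C: "C w = {x}" "C w' = {y}" and bx: "block x \<noteq> 0"
    for w w' x y
  proof -
    have x: "x \<in> B w" "block x = j" using C(1) bx by (auto simp: C_def)
    have off: "\<forall>z\<in>B w. block z \<noteq> 0"
    proof
      fix z assume "z \<in> B w"
      then show "block z \<noteq> 0" using C(1) bx by (auto simp: C_def)
    qed
    obtain a b where ab: "a \<in> B w" "b \<in> B w'" "(a, b) \<in> parcs S"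
      using edge[OF w] by blast
    have "block a = j" using confined[OF w(1) off x(1) ab(1)] x(2) by simp
    then have "a \<in> C w" "b \<in> C w'" using ab adj[OF ab(3)] j0 by (auto simp: C_def)
    then show ?thesis using C adj[OF ab(3)] by simp
  qed
  have single_idx: "idx x \<noteq> idx y"
    if w: "w \<in> W" "w' \<in> W" "w \<noteq> w'" and C: "C w = {x}" "C w' = {y}" for w w' x y
  proof (cases "block x = 0 \<and> block y = 0")
    case True
    have "x \<noteq> y" using w C by (auto simp: C_def B_def)
    then show ?thesis using True vertex_eqI[of x y] by auto
  next
    case False
    then show ?thesis
      using off_hub[OF w C] off_hub[OF w(2,1) w(3)[symmetric] C(2,1)] by auto
  qed
  have elem: "C w = {the_elem (C w)}" if "w \<in> W1" for w
  proof -
    have "card (C w) = 1" using that by (simp add: W1_def)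
    then obtain x where "C w = {x}" by (rule card_1_singletonE)
    then show ?thesis by simp
  qed
  have "inj_on (\<lambda>w. idx (the_elem (C w))) W1"
  proof (rule inj_onI, rule ccontr)
    fix w w' assume w: "w \<in> W1" "w' \<in> W1" "w \<noteq> w'"
      and eq: "idx (the_elem (C w)) = idx (the_elem (C w'))"
    have "w \<in> W" "w' \<in> W" using w by (auto simp: W1_def)
    from single_idx[OF this w(3) elem[OF w(1)] elem[OF w(2)]] eq show False by contradiction
  qed
  moreover have "(\<lambda>w. idx (the_elem (C w))) ` W1 \<subseteq> {..<r + d}"
  proof (clarify, simp)
    fix w assume "w \<in> W1"
    then have "the_elem (C w) \<in> C w" using elem[of w] by blast
    then have "the_elem (C w) \<in> V" using BV[of w] by (auto simp: C_def)
    then show "idx (the_elem (C w)) < r + d" by (simp add: V_def idx_less)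
  qed
  ultimately have W1: "card W1 \<le> r + d"
    using card_inj_on_le[of _ W1 "{..<r + d}"] by simp
  \<comment> \<open>Counting singletons twice gives each restricted set weight at least 2. As these
    sets are disjoint, the total is at most \<open>(2 * r + d) + (r + d)\<close>.\<close>
  have "2 * p = (\<Sum>w\<in>W. 2)" using cM by (simp add: W_def)
  also have "\<dots> \<le> (\<Sum>w\<in>W. card (C w) + of_bool (card (C w) = 1))"
  proof (rule sum_mono)
    fix w assume "w \<in> W"
    then have "card (C w) \<noteq> 0" using C_ne finC by simp
    then show "2 \<le> card (C w) + of_bool (card (C w) = 1)" by (cases "card (C w) = 1") auto
  qed
  also have "\<dots> = card (\<Union>w\<in>W. C w) + card W1"
  proof -
    have "card (\<Union>w\<in>W. C w) = (\<Sum>w\<in>W. card (C w))"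
      using finW finC by (intro card_UN_disjoint) (auto simp: C_def B_def)
    moreover have "(\<Sum>w\<in>W. of_bool (card (C w) = 1)) = card W1"
      using finW by (simp add: W1_def Int_def)
    ultimately show ?thesis by (simp add: sum.distrib)
  qed
  also have "card (\<Union>w\<in>W. C w) \<le> card {x \<in> V. block x = 0 \<or> block x = j}"
    using BV finV by (intro card_mono) (auto simp: C_def)
  also have "\<dots> \<le> 2 * r + d" unfolding V_def by (rule card_hub_block)
  finally show False using W1 p by simp
qed

section \<open>Lists defeating every colouring of the hub\<close>

lemma not_choosable_pasted:
  assumes "r \<ge> 1"
  shows "\<exists>N. \<not> choosable (2 * r - 2 + d) (pasted N r d)"
proof -
  define k where "k = 2 * r - 2 + d"
  \<comment> \<open>All hub colourings from \<open>{..<k}\<close>, enumerated from 1 because block 0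
    is the hub.\<close>
  define P where "P = {..<r + d} \<rightarrow>\<^sub>E {..<k}"
  have "finite P" by (simp add: P_def finite_PiE)
  then obtain F where "bij_betw F {1..card P} P" using ex_bij_betw_nat_finite_1 by blast
  then obtain N where F: "P = F ` {1..N::nat}" by (auto simp: bij_betw_def)
  \<comment> \<open>The colours from \<open>k\<close> on are the \<open>r - 1\<close> common ones.
    The default \<open>{..<k}\<close> serves the hub, and also the blocks of non-injective
    colourings, which no proper colouring of the hub selects.\<close>
  define L where "L x = (if block x \<noteq> 0 \<and> inj_on (F (block x)) {..<r + d}
      then F (block x) ` ({..<r + d} - {idx x}) \<union> {k..<k + (r - 1)} else {..<k})" for x
  have range: "F j i < k" if "j \<in> {1..N}" "i < r + d" for i j
    using that F by (auto simp: P_def)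
  have "card (L x) = k" if x: "x \<in> pasted_verts N r d" for x
  proof (cases "block x \<noteq> 0 \<and> inj_on (F (block x)) {..<r + d}")
    case True
    let ?A = "F (block x) ` ({..<r + d} - {idx x})"
    have b: "block x \<in> {1..N}" using True x by (auto simp: pasted_verts_def)
    have "?A \<inter> {k..<k + (r - 1)} = {}" using range[OF b] by fastforce
    then have "card (L x) = card ?A + (r - 1)"
      using True by (simp add: L_def card_Un_disjoint)
    also have "card ?A = r + d - 1"
      using True idx_less[OF x] by (subst card_image) (auto intro: inj_on_subset)
    finally show ?thesis using assms by (simp add: k_def)
  next
    case False
    then show ?thesis by (auto simp: L_def)
  qed
  moreover have "\<not> list_colourable (pasted N r d) L"
  proof
    assume "list_colourable (pasted N r d) L"
    then obtain c where proper: "\<And>x y. (x, y) \<in> parcs (pasted N r d) \<Longrightarrow> c x \<noteq> c y"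
      and cL: "\<And>x. x \<in> pasted_verts N r d \<Longrightarrow> c x \<in> L x"
      by (auto simp: list_colourable_def proper_colouring_def pasted_def)
    define h where "h = restrict (\<lambda>i. c (prod_encode (0, i))) {..<r + d}"
    have hub: "prod_encode (0, i) \<in> pasted_verts N r d" if "i < r + d" for i
      using that by (auto simp: pasted_verts_def)
    have "h \<in> P"
      using cL[OF hub] by (auto simp: P_def h_def L_def)
    then obtain j where j: "j \<in> {1..N}" "F j = h" using F by auto
    have inj: "inj_on h {..<r + d}"
      by (rule inj_onI, rule ccontr) (use proper hub in \<open>auto simp: h_def pasted_def\<close>)
    define g where "g i = c (prod_encode (j, i))" for i
    have gv: "prod_encode (j, i) \<in> pasted_verts N r d" if "i < r" for i
      using that j by (auto simp: pasted_verts_def)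
    have "g i \<in> {k..<k + (r - 1)}" if i: "i < r" for i
    proof -
      have "g i \<in> h ` ({..<r + d} - {i}) \<union> {k..<k + (r - 1)}"
        using cL[OF gv[OF i]] j inj by (simp add: L_def g_def)
      \<comment> \<open>The vertex \<open>(j, i)\<close> is adjacent to every hub vertex of another
        index, so only common colours remain for it.\<close>
      moreover have "g i \<noteq> h i'" if "i' < r + d" "i' \<noteq> i" for i'
        using that proper[of "prod_encode (j, i)" "prod_encode (0, i')"] gv[OF i] hub
        by (simp add: g_def h_def pasted_def)
      ultimately show ?thesis by auto
    qed
    moreover have "inj_on g {..<r}"
      by (rule inj_onI, rule ccontr) (use proper gv in \<open>auto simp: g_def pasted_def\<close>)
    ultimately have "card {..<r} \<le> card {k..<k + (r - 1)}"
      by (intro card_inj_on_le) auto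
    then show False using assms by simp
  qed
  ultimately have "\<not> choosable k (pasted N r d)"
    by (auto simp: choosable_def pasted_def)
  then show ?thesis unfolding k_def by blast
qed

lemma pasted_counterexample:
  assumes "r \<ge> 1" "3 * r + 2 * d < 2 * p" "k = 2 * r - 2 + d"
  shows "\<exists>G :: nat pair_pre_digraph. pair_graph G \<and> complete_minor_free p G \<and> \<not> choosable k G"
  using pair_graph_pasted complete_minor_free_pasted[OF assms(2)] not_choosable_pasted[OF assms(1)]
    assms(3) by blast

theorem theorem1:
  fixes t :: nat
  assumes "t \<ge> 1"
  shows "(\<exists>G :: nat pair_pre_digraph.
            pair_graph G \<and> complete_minor_free (3 * t + 2) G \<and> \<not> choosable (4 * t) G) \<and>
         (\<exists>G :: nat pair_pre_digraph.
            pair_graph G \<and> complete_minor_free (3 * t + 1) G \<and> \<not> choosable (4 * t - 2) G) \<and>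
         (\<exists>G :: nat pair_pre_digraph.
            pair_graph G \<and> complete_minor_free (3 * t) G \<and> \<not> choosable (4 * t - 3) G)"
proof (intro conjI)
  show "\<exists>G :: nat pair_pre_digraph.
      pair_graph G \<and> complete_minor_free (3 * t + 2) G \<and> \<not> choosable (4 * t) G"
    by (rule pasted_counterexample[where r = "2 * t + 1" and d = 0]) auto
  show "\<exists>G :: nat pair_pre_digraph.
      pair_graph G \<and> complete_minor_free (3 * t + 1) G \<and> \<not> choosable (4 * t - 2) G"
    by (rule pasted_counterexample[where r = "2 * t" and d = 0]) (use assms in auto)
  show "\<exists>G :: nat pair_pre_digraph.
      pair_graph G \<and> complete_minor_free (3 * t) G \<and> \<not> choosable (4 * t - 3) G"
    \<comment> \<open>The dominant vertex fixes the parity: \<open>3 * r + 2 * d\<close> is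
      \<open>6 * t - 1\<close>, just below twice \<open>3 * t\<close>.\<close>
    by (rule pasted_counterexample[where r = "2 * t - 1" and d = 1]) (use assms in auto)
qed

end
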